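(* Let $\rho_0$ denote the standard Euclidean metric on $\mathbb{R}^2$. Then the topological Borsuk number $B(\mathbb{R}^2)$ of $(\mathbb{R}^2,\rho_0)$ is equal to $3$. That is, for every metric $\rho$ on $\mathbb{R}^2$ inducing the standard (Euclidean) topology, we have $B(\mathbb{R}^2,\rho)\ge 3$, and there exists such a metric $\rho$ with $B(\mathbb{R}^2,\rho)=3$; equivalently $\min_{\rho} B(\mathbb{R}^2,\rho)=3$, the minimum taken over all metrics $\rho$ on $\mathbb{R}^2$ inducing the Euclidean topology.
   Context: For a metric space $(X,\rho)$ and a compact set $F\subset X$, the Borsuk number $b_{(X,\rho)}(F)$ is the minimal number of parts (subsets) into which $F$ can be partitioned so that each part has diameter (with respect to $\rho$) strictly smaller than the diameter of $F$. The Borsuk number $B(X,\rho)$ of the metric space is the number such that every compact subset of $X$ can be partitioned into $B(X,\rho)$ parts of smaller diameter, but some compact subset cannot be partitioned into $B(X,\rho)-1$ such parts (i.e. $B(X,\rho)=\sup_F b_{(X,\rho)}(F)$ over compact $F\subset X$). For a metric space $(X,\rho_0)$, let $\Omega(\rho_0)$ be the set of metrics on $X$ defining the same topology as $\rho_0$. The topological Borsuk number of $(X,\rho_0)$ is $B(X)=\min_{\rho\in\Omega(\rho_0)}B(X,\rho)$. *)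

theory Defs
  imports "HOL-Analysis.Analysis" "HOL-Library.Extended_Nat" "HOL-Library.Disjoint_Sets"
begin

(* Same convention as the type-class constant diameter; like there, the value is
   meaningful only for bounded sets, and below it is only used for subsets of compact sets. *)
definition mdiameter :: "'a metric \<Rightarrow> 'a set \<Rightarrow> real" where
  "mdiameter m S = (if S = {} then 0 else SUP (x,y)\<in>S\<times>S. mdist m x y)"

definition smaller_diameter_partition :: "'a metric \<Rightarrow> 'a set \<Rightarrow> 'a set set \<Rightarrow> bool" where
  "smaller_diameter_partition m F P \<longleftrightarrow>
     finite P \<and> partition_on F P \<and> (\<forall>A\<in>P. mdiameter m A < mdiameter m F)"

(* The infimum of a set of extended naturals is its least element, or infinity if it is empty. *)
definition borsuk_number :: "'a metric \<Rightarrow> 'a set \<Rightarrow> enat" where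
  "borsuk_number m F = Inf {enat (card P) |P. smaller_diameter_partition m F P}"

(* Compact sets of diameter 0 are left out: a one-point set has no nonempty
   subset of strictly smaller diameter, so the notion is void for it. *)
definition borsuk_number_space :: "'a metric \<Rightarrow> enat" where
  "borsuk_number_space m =
     Sup (borsuk_number m ` {F. compactin (mtopology_of m) F \<and> mdiameter m F > 0})"

definition equivalent_metrics :: "'a metric \<Rightarrow> 'a metric set" where
  "equivalent_metrics m0 = {m. mspace m = mspace m0 \<and> mtopology_of m = mtopology_of m0}"

(* The infimum is a minimum: the set is nonempty (it contains the value at m0)
   and the extended naturals are well-ordered. *)
definition topological_borsuk_number :: "'a metric \<Rightarrow> enat" where
  "topological_borsuk_number m0 = Inf (borsuk_number_space ` equivalent_metrics m0)"

end

(* Lower bound.  For a metric inducing the topology of a Euclidean space of dimension at least 2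
   there are three points at equal positive distances r, and such a triple cannot be split into two
   parts of smaller diameter.  Take r small, let U a be the component of a in the open ball of
   radius r around a, and let K a be the outer boundary of U a: a connected subset of the sphere of
   radius r.  If b and x in K a are at distance at least r, then by connectedness some y in K a has
   distance exactly r from b, and a, b, y is the required triple.  Otherwise K a is contained in
   U b for every b in K a, so that the region enclosed by K b contains the one enclosed by K a;
   iterating gives a bounded sequence whose points are uniformly separated in the Euclidean metric.

   Upper bound.  Take the norm whose unit ball is an affine hexagon.  A set F of diameter d is
   described by three coordinates u, v, w with values in [0,d] and constant sum s.  If s is at most
   3d/2, split F according to which coordinate is the largest, otherwise according to which is the
   smallest; each part has diameter at most 3d/4. *)

theory Submission
  imports Defs
begin

section \<open>Outer boundaries of bounded connected sets\<close>

text \<open>In dimension at least 2 the outside of a bounded set is connected, hence a single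
  component of the complement; for connected \<open>U\<close> every such component has a connected
  frontier.\<close>

lemma frontier_outside_connected:
  fixes U :: "'a::euclidean_space set"
  assumes "bounded U" "connected U" "U \<noteq> {}" "2 \<le> DIM('a)"
  shows "connected (frontier (outside U))"
    and "frontier (outside U) \<noteq> {}"
    and "frontier (outside U) \<subseteq> frontier U"
proof -
  have ne: "outside U \<noteq> {}"
    using unbounded_outside[OF assms(1)] by auto
  have comp: "outside U \<in> components (- U)"
    by (simp add: outside_in_components connected_outside assms(1,4) ne)
  show "connected (frontier (outside U))"
    using connected_frontier_component_complement[OF assms(2) comp] .
  show "frontier (outside U) \<noteq> {}"
    using ne assms(3) outside_no_overlap[of U] frontier_not_empty[of "outside U"] by blast
  show "frontier (outside U) \<subseteq> frontier U"
    using frontier_of_components_subset[OF comp] by simp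
qed

text \<open>\<open>outside V\<close> is cobounded and \<open>outside U\<close> unbounded, so the two
  meet; if the connected set \<open>outside V\<close> also left \<open>outside U\<close>, it would
  cross a frontier that is contained in \<open>V\<close>.\<close>

lemma outside_subset_if_frontier_outside_subset:
  fixes U V :: "'a::euclidean_space set"
  assumes "bounded U" "bounded V" "frontier (outside U) \<subseteq> V" "2 \<le> DIM('a)"
  shows "outside V \<subseteq> outside U"
proof (rule ccontr)
  assume "\<not> outside V \<subseteq> outside U"
  moreover have "outside V \<inter> outside U \<noteq> {}"
  proof
    assume "outside V \<inter> outside U = {}"
    then have "outside U \<subseteq> - outside V" by blast
    then have "bounded (outside U)"
      using cobounded_outside[OF assms(2)] bounded_subset by blast
    then show False using unbounded_outside[OF assms(1)] by blast
  qed
  ultimately have "outside V \<inter> frontier (outside U) \<noteq> {}"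
    using connected_Int_frontier[of "outside V" "outside U"]
      connected_outside[OF assms(2,4)] by blast
  then show False using assms(3) outside_no_overlap[of V] by blast
qed

lemma no_separated_sequence_in_compact:
  fixes f :: "nat \<Rightarrow> 'a::metric_space"
  assumes "compact S" "\<And>n. f n \<in> S" "e > 0"
  shows "\<exists>m n. m < n \<and> dist (f m) (f n) < e"
proof -
  obtain l s where s: "strict_mono (s :: nat \<Rightarrow> nat)" "(f \<circ> s) \<longlonglongrightarrow> l"
    using assms(1,2) unfolding compact_def by blast
  then have "Cauchy (f \<circ> s)" using LIMSEQ_imp_Cauchy by blast
  then obtain N where "\<And>m n. m \<ge> N \<Longrightarrow> n \<ge> N \<Longrightarrow> dist ((f \<circ> s) m) ((f \<circ> s) n) < e"
    using assms(3) unfolding Cauchy_def by metis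
  then have "dist (f (s N)) (f (s (Suc N))) < e" by simp
  then show ?thesis using s(1) strict_monoD lessI by blast
qed

section \<open>Equilateral triples for a continuous distance function\<close>

lemma exists_equilateral_triple:
  fixes d :: "'a::euclidean_space \<Rightarrow> 'a \<Rightarrow> real"
  assumes dim: "2 \<le> DIM('a)"
    and cont: "continuous_on UNIV (\<lambda>p. d (fst p) (snd p))"
    and nonneg: "\<And>x y. 0 \<le> d x y"
    and zero: "\<And>x y. d x y = 0 \<longleftrightarrow> x = y"
    and sym: "\<And>x y. d x y = d y x"
  obtains x y z r where "r > 0" "d x y = r" "d y z = r" "d x z = r"
proof -
  have pos: "0 < d x y \<longleftrightarrow> x \<noteq> y" for x y
    using nonneg[of x y] zero[of x y] by linarith
  have cont1: "continuous_on S (d a)" for a S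
    using continuous_on_compose2[OF cont, of S "\<lambda>x. (a, x)"]
    by (simp add: continuous_on_Pair)
  \<comment> \<open>Centres will have norm at most 2 and are compared with points at Euclidean
    distance at most 1, so radius 3 leaves enough room.\<close>
  define D :: "'a set" where "D = cball 0 3"
  obtain r where r: "r > 0"
    and near: "\<And>x y. x \<in> D \<Longrightarrow> y \<in> D \<Longrightarrow> d x y < r \<Longrightarrow> dist x y < 1"
  proof (cases "\<exists>x\<in>D. \<exists>y\<in>D. dist x y \<ge> 1")
    case True
    \<comment> \<open>The minimum of \<open>d\<close> over this compact set of pairs serves as
      \<open>r\<close>; it is positive because \<open>T\<close> misses the diagonal.\<close>
    define T where "T = (D \<times> D) \<inter> {p. dist (fst p) (snd p) \<ge> 1}"
    have "compact T"
      unfolding T_def D_def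
      by (intro compact_Int_closed compact_Times compact_cball closed_Collect_le continuous_intros)
    moreover have "T \<noteq> {}" using True unfolding T_def by auto
    ultimately obtain p where p: "p \<in> T"
      "\<And>q. q \<in> T \<Longrightarrow> d (fst p) (snd p) \<le> d (fst q) (snd q)"
      using continuous_attains_inf[of T "\<lambda>p. d (fst p) (snd p)"]
        continuous_on_subset[OF cont subset_UNIV] by blast
    have "fst p \<noteq> snd p" using p(1) unfolding T_def by auto
    then have "d (fst p) (snd p) > 0" using pos by blast
    moreover have "dist x y < 1" if "x \<in> D" "y \<in> D" "d x y < d (fst p) (snd p)" for x y
      using p(2)[of "(x,y)"] that unfolding T_def by force
    ultimately show ?thesis using that by blast
  next
    case False
    then show ?thesis using that[of 1] by (meson not_le zero_less_one)
  qed
  have "uniformly_continuous_on (D \<times> D) (\<lambda>p. d (fst p) (snd p))"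
    using compact_uniformly_continuous[of "D \<times> D" "\<lambda>p. d (fst p) (snd p)"]
      continuous_on_subset[OF cont subset_UNIV]
    by (simp add: D_def compact_Times)
  then obtain \<delta> where \<delta>: "\<delta> > 0"
    "\<And>p q. p \<in> D \<times> D \<Longrightarrow> q \<in> D \<times> D \<Longrightarrow> dist q p < \<delta>
       \<Longrightarrow> dist (d (fst q) (snd q)) (d (fst p) (snd p)) < r"
    using r unfolding uniformly_continuous_on_def by metis
  \<comment> \<open>With this \<open>e\<close>, chosen uniformly in the centre, Euclidean balls of
    radius \<open>e\<close> lie in \<open>d\<close>-balls of radius \<open>r\<close>; the cap 1
    keeps them inside \<open>D\<close>. The same \<open>e\<close> later separates the points of the
    sequence.\<close>
  define e where "e = min \<delta> 1"
  have e: "e > 0" using \<delta>(1) by (simp add: e_def)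
  have small: "d a x < r" if "norm a \<le> 2" "dist a x < e" for a x
  proof -
    have "norm x \<le> norm a + dist a x"
      by (metis dist_norm norm_minus_commute norm_triangle_sub)
    then have "x \<in> D" "a \<in> D" using that by (auto simp: D_def e_def)
    then have "dist (d a x) (d a a) < r"
      using \<delta>(2)[of "(a,a)" "(a,x)"] that by (simp add: e_def dist_Pair_Pair dist_commute)
    then show ?thesis using zero[of a a] nonneg[of a x] by (simp add: dist_real_def)
  qed
  define B where "B a = {x. d a x < r}" for a
  \<comment> \<open>\<open>B a\<close> may have pieces outside \<open>D\<close>, where
    \<open>near\<close> gives no control. For \<open>norm a \<le> 2\<close> the component of
    \<open>a\<close> cannot cross the Euclidean unit sphere around \<open>a\<close>, so it stays in
    the unit ball.\<close>
  define U where "U a = connected_component_set (B a) a" for a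
  define K where "K a = frontier (outside (U a))" for a
  have openB: "open (B a)" for a
    unfolding B_def by (intro open_Collect_less cont1 continuous_on_const)
  have openU: "open (U a)" for a
    unfolding U_def by (intro open_connected_component openB)
  have connU: "connected (U a)" for a
    unfolding U_def by simp
  have aU: "a \<in> U a" for a
    using r zero[of a a] by (simp add: U_def B_def)
  have U_sub: "U a \<subseteq> B a" for a
    unfolding U_def by (rule connected_component_subset)
  have U_ball: "U a \<subseteq> ball a 1" if "norm a \<le> 2" for a
  proof (rule ccontr)
    assume "\<not> U a \<subseteq> ball a 1"
    moreover have "a \<in> U a \<inter> ball a 1" using aU[of a] by simp
    ultimately have "U a \<inter> frontier (ball a 1) \<noteq> {}"
      by (intro connected_Int_frontier connU) blast+
    then obtain x where "x \<in> U a" "x \<in> frontier (ball a 1)" by blast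
    then have x: "x \<in> U a" "dist a x = 1" by simp_all
    have "norm x \<le> norm a + dist a x"
      by (metis dist_norm norm_minus_commute norm_triangle_sub)
    then have "x \<in> D" "a \<in> D" using that x(2) by (auto simp: D_def)
    moreover have "d a x < r" using x(1) U_sub[of a] by (auto simp: B_def)
    ultimately show False using near x(2) by fastforce
  qed
  have ball_U: "ball a e \<subseteq> U a" if "norm a \<le> 2" for a
    unfolding U_def
    using small[OF that] e by (intro connected_component_maximal) (auto simp: B_def)
  have bddU: "bounded (U a)" if "norm a \<le> 2" for a
    using U_ball[OF that] bounded_ball bounded_subset by blast
  have outU: "- ball a 1 \<subseteq> outside (U a)" if "norm a \<le> 2" for a
    using outside_mono[OF U_ball[OF that]] outside_convex[of "ball a 1"] by simp
  have K_ball: "K a \<subseteq> cball a 1" if "norm a \<le> 2" for a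
  proof -
    have "interior (- ball a 1) \<subseteq> interior (outside (U a))"
      using outU[OF that] interior_mono by blast
    then show ?thesis unfolding K_def frontier_def
      by (auto simp: interior_complement)
  qed
  \<comment> \<open>A frontier point of a component of the open set \<open>B a\<close> is a frontier
    point of \<open>B a\<close> itself: it is a limit of points with \<open>d a x < r\<close> but
    not one of them.\<close>
  have K_sphere: "d a x = r" if "norm a \<le> 2" "x \<in> K a" for a x
  proof -
    have "frontier (outside (U a)) \<subseteq> frontier (U a)"
      using frontier_outside_connected(3)[OF bddU[OF that(1)] connU _ dim] aU by blast
    also have "\<dots> \<subseteq> frontier (B a)"
      unfolding U_def by (rule frontier_of_connected_component_subset)
    finally have "x \<in> closure (B a) - B a"
      using that(2) openB[of a] unfolding K_def frontier_def by (auto simp: interior_open)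
    moreover have "closure (B a) \<subseteq> {x. d a x \<le> r}"
      by (intro closure_minimal closed_Collect_le cont1 continuous_on_const) (auto simp: B_def)
    ultimately show ?thesis by (auto simp: B_def)
  qed
  have connK: "connected (K a)" and K_ne: "K a \<noteq> {}" if "norm a \<le> 2" for a
    unfolding K_def
    using frontier_outside_connected(1,2)[OF bddU[OF that] connU _ dim] aU by blast+
  show ?thesis
  proof (rule ccontr)
    assume "\<not> thesis"
    then have NE: "\<not> (d x y = r \<and> d y z = r \<and> d x z = r)" for x y z
      using that r by blast
    have K_U: "K a \<subseteq> U b" if "norm a \<le> 2" "b \<in> K a" for a b
    proof -
      have "K a \<subseteq> B b"
      proof (rule ccontr)
        assume "\<not> K a \<subseteq> B b"
        then obtain x where "x \<in> K a" "x \<notin> B b" by blast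
        then have x: "x \<in> K a" "d b x \<ge> r" by (simp_all add: B_def)
        have "connected (d b ` K a)"
          using connK[OF that(1)] cont1 connected_continuous_image by blast
        moreover have "0 \<in> d b ` K a" using zero[of b b] that(2) by force
        ultimately have "r \<in> d b ` K a"
          using x r connectedD_interval[of "d b ` K a" 0 "d b x" r] by auto
        then obtain y where "y \<in> K a" "d b y = r" by auto
        then show False using NE[of a b y] K_sphere that by blast
      qed
      then show ?thesis
        unfolding U_def using connK[OF that(1)] that(2) by (intro connected_component_maximal)
    qed
    \<comment> \<open>The invariant that keeps the iteration bounded: a priori \<open>b\<close> only
      has norm at most 2, but 0 is still not outside \<open>U b\<close>, and \<open>U b\<close> lies
      in the unit ball around \<open>b\<close>, so \<open>norm b \<le> 1\<close> again.\<close>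
    have step: "norm b \<le> 1 \<and> 0 \<notin> outside (U b) \<and> outside (U b) \<subseteq> outside (U a)"
      if "norm a \<le> 1" "0 \<notin> outside (U a)" "b \<in> K a" for a b
    proof -
      have a2: "norm a \<le> 2" using that(1) by simp
      have "norm b \<le> norm a + dist a b"
        by (metis dist_norm norm_minus_commute norm_triangle_sub)
      then have b2: "norm b \<le> 2" using that(1,3) K_ball[OF a2] by auto
      have sub: "outside (U b) \<subseteq> outside (U a)"
        using outside_subset_if_frontier_outside_subset[OF bddU[OF a2] bddU[OF b2] _ dim]
          K_U[OF a2 that(3)] unfolding K_def by blast
      then have "0 \<notin> outside (U b)" using that(2) by blast
      then have "0 \<in> ball b 1" using outU[OF b2] by blast
      then show ?thesis using sub that(2) by auto
    qed
    define P where "P a \<longleftrightarrow> norm a \<le> 1 \<and> 0 \<notin> outside (U a)" for a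
    have "P 0" unfolding P_def using aU[of 0] outside_no_overlap[of "U 0"]
      unfolding disjoint_iff by (metis norm_zero zero_le_one)
    moreover have "\<exists>b. P b \<and> b \<in> K a" if "P a" for a
    proof -
      have "norm a \<le> 2" using that by (simp add: P_def)
      then obtain b where "b \<in> K a" using K_ne by blast
      then show ?thesis using step that unfolding P_def by blast
    qed
    ultimately obtain f where f: "\<And>n. P (f n)" "\<And>n. f (Suc n) \<in> K (f n)"
      using dependent_nat_choice[of "\<lambda>_. P" "\<lambda>_ a b. b \<in> K a"] by blast
    have mono: "outside (U (f n)) \<subseteq> outside (U (f m))" if "m \<le> n" for m n
      using that
    proof (rule lift_Suc_antimono_le[where f = "\<lambda>n. outside (U (f n))", rotated])
      show "outside (U (f (Suc n))) \<subseteq> outside (U (f n))" for n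
        using step f unfolding P_def by blast
    qed
    \<comment> \<open>With \<open>n = Suc k\<close>, the point \<open>f n\<close> is on the frontier
      of \<open>outside (U (f k))\<close>, hence in the closure of the larger set
      \<open>outside (U (f m))\<close>. This closure misses the open set \<open>U (f m)\<close>,
      which contains the ball of radius \<open>e\<close> around \<open>f m\<close>.\<close>
    have sep: "dist (f m) (f n) \<ge> e" if less: "m < n" for m n
    proof -
      obtain k where k: "n = Suc k" "m \<le> k" using less by (cases n) auto
      have "closure (outside (U (f k))) \<subseteq> closure (outside (U (f m)))"
        using mono[OF k(2)] by (rule closure_mono)
      also have "\<dots> \<subseteq> - U (f m)"
        using openU[of "f m"] outside_no_overlap[of "U (f m)"] by (intro closure_minimal) blast+
      finally have "f n \<notin> U (f m)"
        using f(2)[of k] unfolding k(1) K_def frontier_def by blast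
      then show ?thesis using ball_U[of "f m"] f(1)[of m] unfolding P_def by force
    qed
    have "\<And>n. f n \<in> cball 0 1" using f(1) unfolding P_def by auto
    then show False
      using no_separated_sequence_in_compact[OF compact_cball _ e, of f 0 1] sep
      by (meson not_le)
  qed
qed

section \<open>Diameters and the lower bound 3\<close>

text \<open>A supremum of reals dominates its members only when they are bounded above; the bound
  \<open>c\<close> provides this.\<close>

lemma mdist_le_mdiameter:
  assumes "\<And>x y. x \<in> S \<Longrightarrow> y \<in> S \<Longrightarrow> mdist m x y \<le> c" "x \<in> S" "y \<in> S"
  shows "mdist m x y \<le> mdiameter m S"
proof -
  have "bdd_above ((\<lambda>(x,y). mdist m x y) ` (S \<times> S))"
    using assms(1) by (auto intro!: bdd_aboveI[where M = c])
  then show ?thesis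
    using cSUP_upper[of "(x,y)" "S \<times> S" "\<lambda>(x,y). mdist m x y"] assms(2,3)
    unfolding mdiameter_def by auto
qed

lemma mdiameter_le:
  assumes "\<And>x y. x \<in> S \<Longrightarrow> y \<in> S \<Longrightarrow> mdist m x y \<le> c" "0 \<le> c"
  shows "mdiameter m S \<le> c"
  using assms unfolding mdiameter_def by (auto intro!: cSUP_least)

text \<open>Any two distinct points realise the full diameter, so a part of smaller diameter holds
  at most one of the three.\<close>

lemma borsuk_number_equilateral:
  assumes xyz: "mdist m x y = r" "mdist m y z = r" "mdist m x z = r" "r > 0"
    and M: "x \<in> mspace m" "y \<in> mspace m" "z \<in> mspace m"
  shows "borsuk_number m {x,y,z} \<ge> 3" and "mdiameter m {x,y,z} = r"
proof -
  have "mdist m x x = 0" "mdist m y y = 0" "mdist m z z = 0"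
    using M by simp_all
  then have le: "mdist m a b \<le> r" if "a \<in> {x,y,z}" "b \<in> {x,y,z}" for a b
    using that xyz mdist_commute[of m y x] mdist_commute[of m z y] mdist_commute[of m z x]
    by auto
  show diam: "mdiameter m {x,y,z} = r"
    using mdiameter_le[of "{x,y,z}" m r, OF le] mdist_le_mdiameter[of "{x,y,z}" m r x y, OF le] xyz
    by auto
  have eq: "mdist m a b = r" if "a \<in> {x,y,z}" "b \<in> {x,y,z}" "a \<noteq> b" for a b
    using that xyz by (auto simp: mdist_commute)
  have "3 \<le> enat (card P)" if P: "smaller_diameter_partition m {x,y,z} P" for P
  proof -
    have fin: "finite P" and part: "partition_on {x,y,z} P"
      and small: "\<And>A. A \<in> P \<Longrightarrow> mdiameter m A < r"
      using P diam unfolding smaller_diameter_partition_def by auto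
    have one: "a = b" if "A \<in> P" "a \<in> A" "b \<in> A" for A a b
    proof (rule ccontr)
      assume "a \<noteq> b"
      have sub: "A \<subseteq> {x,y,z}" using partition_onD1[OF part] that(1) by blast
      then have "mdist m a b = r" using that \<open>a \<noteq> b\<close> by (intro eq) blast+
      moreover have "mdist m a b \<le> mdiameter m A"
        using sub that(2,3) by (intro mdist_le_mdiameter[where c = r] le) blast+
      ultimately show False using small[OF that(1)] by simp
    qed
    have "card {x,y,z} \<le> card P"
    proof (rule card_le_if_inj_on_rel[where r = "\<lambda>a A. a \<in> A", OF fin])
      show "\<exists>A. A \<in> P \<and> a \<in> A" if "a \<in> {x,y,z}" for a
      proof -
        have "a \<in> \<Union>P" using that unfolding partition_onD1[OF part] .
        then show ?thesis by blast
      qed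
        qed (rule one)
    moreover have "x \<noteq> y" "y \<noteq> z" "x \<noteq> z"
      using xyz M by (metis mdist_zero order_less_irrefl)+
    ultimately have "3 \<le> card P" by simp
    then show ?thesis by (metis enat_ord_simps(1) numeral_eq_enat)
  qed
  then show "borsuk_number m {x,y,z} \<ge> 3"
    unfolding borsuk_number_def le_Inf_iff by blast
qed

lemma borsuk_number_space_ge_3:
  fixes \<rho> :: "'a::euclidean_space metric"
  assumes "2 \<le> DIM('a)" and \<rho>: "\<rho> \<in> equivalent_metrics euclidean_metric"
  shows "borsuk_number_space \<rho> \<ge> 3"
proof -
  have sp: "mspace \<rho> = UNIV" and top: "mtopology_of \<rho> = euclidean"
    using \<rho> by (auto simp: equivalent_metrics_def)
  \<comment> \<open>A metric is jointly continuous for its own topology, which here is the Euclidean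
    one.\<close>
  have "continuous_map euclidean euclideanreal (\<lambda>p. mdist \<rho> (fst p) (snd p :: 'a))"
    by (intro continuous_map_mdist) (auto simp: top continuous_on_fst continuous_on_snd)
  then have cont: "continuous_on UNIV (\<lambda>p. mdist \<rho> (fst p) (snd p))" by simp
  obtain x y z r where xyz: "r > 0" "mdist \<rho> x y = r" "mdist \<rho> y z = r" "mdist \<rho> x z = r"
  proof (rule exists_equilateral_triple[OF assms(1) cont])
    show "mdist \<rho> x y = mdist \<rho> y x" for x y
      by (rule mdist_commute)
  qed (use sp in simp_all)
  have le: "3 \<le> borsuk_number \<rho> {x,y,z}" and pos: "mdiameter \<rho> {x,y,z} > 0"
    using borsuk_number_equilateral[OF xyz(2-4,1)] sp xyz(1) by auto
  note le
  also have "borsuk_number \<rho> {x,y,z} \<le> borsuk_number_space \<rho>"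
    unfolding borsuk_number_space_def using pos
    by (intro Sup_upper imageI) (auto simp: top intro: finite_imp_compact)
  finally show ?thesis .
qed

section \<open>The hexagonal metric on the plane\<close>

text \<open>Distance of the norm whose unit ball is the hexagon with vertices \<plusminus>(1,0),
  \<plusminus>(0,1), \<plusminus>(1,-1). After a sign change in the last one, the three differences
  sum to 0.\<close>

definition hex_dist :: "real^2 \<Rightarrow> real^2 \<Rightarrow> real" where
  "hex_dist x y =
     max \<bar>x$1 - y$1\<bar> (max \<bar>x$2 - y$2\<bar> \<bar>(x$1 + x$2) - (y$1 + y$2)\<bar>)"

definition hex_metric :: "(real^2) metric" where
  "hex_metric = metric (UNIV, hex_dist)"

lemma hex_dist_le_iff:
  "hex_dist x y \<le> c \<longleftrightarrow>
     \<bar>x$1 - y$1\<bar> \<le> c \<and> \<bar>x$2 - y$2\<bar> \<le> c \<and> \<bar>(x$1 + x$2) - (y$1 + y$2)\<bar> \<le> c"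
  by (simp add: hex_dist_def)

lemma hex_dist_le_dist: "hex_dist x y \<le> 2 * dist x y"
proof -
  have "\<bar>x$1 - y$1\<bar> \<le> dist x y" "\<bar>x$2 - y$2\<bar> \<le> dist x y"
    using component_le_norm_cart[of "x - y"] by (simp_all add: dist_norm)
  then show ?thesis unfolding hex_dist_le_iff by linarith
qed

lemma dist_le_hex_dist: "dist x y \<le> 2 * hex_dist x y"
proof -
  have "dist x y \<le> \<bar>x$1 - y$1\<bar> + \<bar>x$2 - y$2\<bar>"
    using norm_le_l1_cart[of "x - y"] by (simp add: dist_norm sum_2)
  then show ?thesis using hex_dist_le_iff[of x y "hex_dist x y"] by simp
qed

lemma Metric_space_hex_dist: "Metric_space UNIV hex_dist"
proof
  show "0 \<le> hex_dist x y" for x y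
    by (simp add: hex_dist_def)
  show "hex_dist x y = hex_dist y x" for x y
    by (simp add: hex_dist_def abs_minus_commute)
  show "hex_dist x y = 0 \<longleftrightarrow> x = y" for x y
  proof
    assume "hex_dist x y = 0"
    then show "x = y" using dist_le_hex_dist[of x y] by simp
  qed (simp add: hex_dist_def)
  show "hex_dist x z \<le> hex_dist x y + hex_dist y z" for x y z
  proof -
    have tri: "\<bar>p - r\<bar> \<le> a + b" if "\<bar>p - q\<bar> \<le> a" "\<bar>q - r\<bar> \<le> b" for p q r a b :: real
      using that by linarith
    \<comment> \<open>Unfolded by \<open>hex_dist_le_iff\<close>, these reflexive facts bound the
      three coordinate differences, to which \<open>tri\<close> applies one at a time.\<close>
    have "hex_dist x y \<le> hex_dist x y" "hex_dist y z \<le> hex_dist y z"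
      by simp_all
    then show ?thesis
      unfolding hex_dist_le_iff[of x y] hex_dist_le_iff[of y z] hex_dist_le_iff[of x z]
      by (elim conjE) (intro conjI; rule tri; assumption)
  qed
qed

lemma mspace_hex_metric [simp]: "mspace hex_metric = UNIV"
  unfolding hex_metric_def by (rule Metric_space.mspace_metric[OF Metric_space_hex_dist])

lemma mdist_hex_metric [simp]: "mdist hex_metric = hex_dist"
  unfolding hex_metric_def by (rule Metric_space.mdist_metric[OF Metric_space_hex_dist])

lemma mtopology_of_hex_metric [simp]: "mtopology_of hex_metric = euclidean"
proof -
  interpret H: Metric_space UNIV hex_dist
    by (rule Metric_space_hex_dist)
  have "openin H.mtopology S \<longleftrightarrow> open S" for S
  proof -
    \<comment> \<open>The factor 2 in both comparisons with \<open>dist\<close> makes a ball of half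
      the radius fit, in either direction.\<close>
    have "(\<exists>r>0. H.mball x r \<subseteq> S) \<longleftrightarrow> (\<exists>e>0. ball x e \<subseteq> S)" for x
    proof
      assume "\<exists>r>0. H.mball x r \<subseteq> S"
      then obtain r where r: "r > 0" "H.mball x r \<subseteq> S" by blast
      have "ball x (r/2) \<subseteq> H.mball x r"
      proof
        fix y assume "y \<in> ball x (r/2)"
        then show "y \<in> H.mball x r" using hex_dist_le_dist[of x y] by simp
      qed
      then show "\<exists>e>0. ball x e \<subseteq> S" using r half_gt_zero by blast
    next
      assume "\<exists>e>0. ball x e \<subseteq> S"
      then obtain r where r: "r > 0" "ball x r \<subseteq> S" by blast
      have "H.mball x (r/2) \<subseteq> ball x r"
      proof
        fix y assume "y \<in> H.mball x (r/2)"
        then show "y \<in> ball x r" using dist_le_hex_dist[of x y] by simp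
      qed
      then show "\<exists>r>0. H.mball x r \<subseteq> S" using r half_gt_zero by blast
    qed
    then show ?thesis unfolding H.openin_mtopology open_contains_ball by blast
  qed
  then show ?thesis
    by (simp add: topology_eq mtopology_of_def)
qed

lemma hex_metric_equivalent: "hex_metric \<in> equivalent_metrics euclidean_metric"
  by (simp add: equivalent_metrics_def)

section \<open>Splitting a set into three parts of smaller diameter\<close>

text \<open>A cover is enough, since overlaps can be cut away. The uniform bound \<open>c\<close>
  matters: distances that are merely below the diameter could still have it as their
  supremum.\<close>

lemma borsuk_number_le_3I:
  assumes "F = A \<union> B \<union> C"
    and small: "\<And>S x y. S \<in> {A,B,C} \<Longrightarrow> x \<in> S \<Longrightarrow> y \<in> S \<Longrightarrow> mdist m x y \<le> c"
    and c: "0 \<le> c" "c < mdiameter m F"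
  shows "borsuk_number m F \<le> 3"
proof -
  \<comment> \<open>Blocks of a partition are nonempty, so empty pieces are dropped and
    \<open>P\<close> may have fewer than three members.\<close>
  define P where "P = {A, B - A, C - A - B} - {{}}"
  have "partition_on F P"
  proof (rule partition_onI)
    have "\<Union>P = \<Union>{A, B - A, C - A - B}" unfolding P_def by blast
    also have "\<dots> = F" unfolding assms(1) by (simp add: set_eq_iff) blast
    finally show "\<Union>P = F" .
    show "disjnt p q" if "p \<in> P" "q \<in> P" "p \<noteq> q" for p q
    proof -
      have "p \<in> {A, B - A, C - A - B}" "q \<in> {A, B - A, C - A - B}"
        using that(1,2) by (simp_all add: P_def)
      then show ?thesis
        using that(3) by (elim insertE emptyE) (simp_all add: disjnt_iff, blast?)
    qed
  qed (simp add: P_def)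
  moreover have "mdiameter m S < mdiameter m F" if S: "S \<in> P" for S
  proof -
    obtain T where "T \<in> {A,B,C}" "S \<subseteq> T"
      using S unfolding P_def by blast
    then have "mdiameter m S \<le> c"
      using c(1) by (intro mdiameter_le small[of T]) auto
    then show ?thesis using c(2) by simp
  qed
  moreover have "finite P" by (simp add: P_def)
  ultimately have "smaller_diameter_partition m F P"
    by (simp add: smaller_diameter_partition_def)
  then have "borsuk_number m F \<le> enat (card P)"
    unfolding borsuk_number_def by (blast intro: Inf_lower)
  also have "card P \<le> card {A, B - A, C - A - B}"
    unfolding P_def by (intro card_mono) auto
  also have "\<dots> \<le> 3"
    using card_length[of "[A, B - A, C - A - B]"] by simp
  finally show ?thesis by (simp add: numeral_eq_enat)
qed

text \<open>The largest coordinate lies between s/3 and the minimum of d and s, an interval of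
  length at most 2d/3. Each other one lies between 0 and s/2 \<le> 3d/4, because 2b \<le> a + b
  \<le> s.\<close>

lemma dominant_coordinate_close:
  fixes a b c a' b' c' d s :: real
  assumes "b \<le> a" "c \<le> a" "b' \<le> a'" "c' \<le> a'"
    and "0 \<le> b" "0 \<le> c" "0 \<le> b'" "0 \<le> c'" "a \<le> d" "a' \<le> d"
    and "a + b + c = s" "a' + b' + c' = s" "2 * s \<le> 3 * d"
  shows "\<bar>a - a'\<bar> \<le> 3/4 * d" "\<bar>b - b'\<bar> \<le> 3/4 * d" "\<bar>c - c'\<bar> \<le> 3/4 * d"
  by (rule abs_leI; use assms in linarith)+

definition oscillation_le :: "('a \<Rightarrow> real) \<Rightarrow> real \<Rightarrow> 'a set \<Rightarrow> bool" where
  "oscillation_le f c S \<longleftrightarrow> (\<forall>x\<in>S. \<forall>y\<in>S. \<bar>f x - f y\<bar> \<le> c)"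

lemma oscillation_leD: "oscillation_le f c S \<Longrightarrow> x \<in> S \<Longrightarrow> y \<in> S \<Longrightarrow> \<bar>f x - f y\<bar> \<le> c"
  by (simp add: oscillation_le_def)

lemma oscillation_le_reflect [simp]:
  "oscillation_le (\<lambda>x. d - f x) c S \<longleftrightarrow> oscillation_le f c S"
  by (simp add: oscillation_le_def abs_minus_commute)

text \<open>Only the region where the first coordinate is largest is treated; the other two regions
  follow by permuting the functions.\<close>

lemma oscillation_le_dominant:
  fixes u v w :: "'a \<Rightarrow> real"
  assumes u: "\<And>x. x \<in> F \<Longrightarrow> 0 \<le> u x \<and> u x \<le> d"
    and v: "\<And>x. x \<in> F \<Longrightarrow> 0 \<le> v x \<and> v x \<le> d"
    and w: "\<And>x. x \<in> F \<Longrightarrow> 0 \<le> w x \<and> w x \<le> d"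
    and sum: "\<And>x. x \<in> F \<Longrightarrow> u x + v x + w x = s"
    and s: "2 * s \<le> 3 * d"
  defines "S \<equiv> {x\<in>F. v x \<le> u x \<and> w x \<le> u x}"
  shows "oscillation_le u (3/4 * d) S" "oscillation_le v (3/4 * d) S"
    "oscillation_le w (3/4 * d) S"
proof -
  have "\<bar>u x - u y\<bar> \<le> 3/4 * d \<and> \<bar>v x - v y\<bar> \<le> 3/4 * d \<and> \<bar>w x - w y\<bar> \<le> 3/4 * d"
    if "x \<in> S" "y \<in> S" for x y
  proof -
    have x: "x \<in> F" "v x \<le> u x" "w x \<le> u x" and y: "y \<in> F" "v y \<le> u y" "w y \<le> u y"
      using that by (simp_all add: S_def)
    show ?thesis
      using u[OF x(1)] v[OF x(1)] w[OF x(1)] u[OF y(1)] v[OF y(1)] w[OF y(1)]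
      by (intro conjI dominant_coordinate_close
          [OF x(2,3) y(2,3) _ _ _ _ _ _ sum[OF x(1)] sum[OF y(1)] s]) simp_all
  qed
  then show "oscillation_le u (3/4 * d) S" "oscillation_le v (3/4 * d) S"
    "oscillation_le w (3/4 * d) S"
    by (simp_all add: oscillation_le_def)
qed

lemma three_part_cover_low_sum:
  fixes u v w :: "'a \<Rightarrow> real"
  assumes u: "\<And>x. x \<in> F \<Longrightarrow> 0 \<le> u x \<and> u x \<le> d"
    and v: "\<And>x. x \<in> F \<Longrightarrow> 0 \<le> v x \<and> v x \<le> d"
    and w: "\<And>x. x \<in> F \<Longrightarrow> 0 \<le> w x \<and> w x \<le> d"
    and sum: "\<And>x. x \<in> F \<Longrightarrow> u x + v x + w x = s"
    and s: "2 * s \<le> 3 * d"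
  obtains A B C where "F = A \<union> B \<union> C"
    "\<And>S f. S \<in> {A,B,C} \<Longrightarrow> f \<in> {u,v,w} \<Longrightarrow> oscillation_le f (3/4 * d) S"
proof
  let ?A = "{x\<in>F. v x \<le> u x \<and> w x \<le> u x}"
  let ?B = "{x\<in>F. u x \<le> v x \<and> w x \<le> v x}"
  let ?C = "{x\<in>F. u x \<le> w x \<and> v x \<le> w x}"
  show "F = ?A \<union> ?B \<union> ?C" by (rule set_eqI) (simp, argo)
  have sum': "v x + u x + w x = s" "w x + u x + v x = s" if "x \<in> F" for x
    using sum[OF that] by linarith+
  have "oscillation_le u (3/4 * d) ?A" "oscillation_le v (3/4 * d) ?A"
    "oscillation_le w (3/4 * d) ?A"
    by (rule oscillation_le_dominant[OF u v w sum s]; assumption)+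
  moreover have "oscillation_le v (3/4 * d) ?B" "oscillation_le u (3/4 * d) ?B"
    "oscillation_le w (3/4 * d) ?B"
    by (rule oscillation_le_dominant[OF v u w sum'(1) s]; assumption)+
  moreover have "oscillation_le w (3/4 * d) ?C" "oscillation_le u (3/4 * d) ?C"
    "oscillation_le v (3/4 * d) ?C"
    by (rule oscillation_le_dominant[OF w u v sum'(2) s]; assumption)+
  ultimately show "oscillation_le f (3/4 * d) S"
    if "S \<in> {?A,?B,?C}" "f \<in> {u,v,w}" for S f
    using that by (elim insertE emptyE) simp_all
qed

lemma three_part_cover:
  fixes u v w :: "'a \<Rightarrow> real"
  assumes u: "\<And>x. x \<in> F \<Longrightarrow> 0 \<le> u x \<and> u x \<le> d"
    and v: "\<And>x. x \<in> F \<Longrightarrow> 0 \<le> v x \<and> v x \<le> d"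
    and w: "\<And>x. x \<in> F \<Longrightarrow> 0 \<le> w x \<and> w x \<le> d"
    and sum: "\<And>x. x \<in> F \<Longrightarrow> u x + v x + w x = s"
  obtains A B C where "F = A \<union> B \<union> C"
    "\<And>S f. S \<in> {A,B,C} \<Longrightarrow> f \<in> {u,v,w} \<Longrightarrow> oscillation_le f (3/4 * d) S"
proof (cases "2 * s \<le> 3 * d")
  case True
  show ?thesis by (rule three_part_cover_low_sum[OF u v w sum True that])
next
  case False
  \<comment> \<open>Reflection keeps the range [0,d] and all oscillations but changes the sum to 3d
    - s, which is now below 3d/2; a largest reflected coordinate is a smallest original one.\<close>
  let ?r = "\<lambda>f x. d - f x"
  obtain A B C where ABC: "F = A \<union> B \<union> C"
    "\<And>S f. S \<in> {A,B,C} \<Longrightarrow> f \<in> {?r u, ?r v, ?r w} \<Longrightarrow> oscillation_le f (3/4 * d) S"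
  proof (rule three_part_cover_low_sum[of F "?r u" d "?r v" "?r w" "3 * d - s"])
    show "d - u x + (d - v x) + (d - w x) = 3 * d - s" if "x \<in> F" for x
      using sum[OF that] by simp
  qed (use u v w False in simp_all)
  have "oscillation_le f (3/4 * d) S" if "S \<in> {A,B,C}" "f \<in> {u,v,w}" for S f
  proof -
    have "oscillation_le (?r f) (3/4 * d) S" using that by (intro ABC(2)) auto
    then show ?thesis by simp
  qed
  then show ?thesis by (rule that[OF ABC(1)])
qed

text \<open>Used to shift each coordinate into [0,d]; the witness \<open>a\<close> is the infimum of
  \<open>f\<close> over \<open>F\<close>.\<close>

lemma oscillation_le_imp_range:
  fixes f :: "'a \<Rightarrow> real"
  assumes "F \<noteq> {}" "\<And>x y. x \<in> F \<Longrightarrow> y \<in> F \<Longrightarrow> \<bar>f x - f y\<bar> \<le> d"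
  obtains a where "\<And>x. x \<in> F \<Longrightarrow> 0 \<le> f x - a \<and> f x - a \<le> d"
proof
  fix x assume x: "x \<in> F"
  have low: "f x - d \<le> f y" if "y \<in> F" for y
    using assms(2)[OF x that] by linarith
  have "bdd_below (f ` F)"
    by (rule bdd_belowI[of _ "f x - d"]) (use low in blast)
  then have "Inf (f ` F) \<le> f x" using x by (intro cINF_lower)
  moreover have "f x - d \<le> Inf (f ` F)" using assms(1) low by (intro cINF_greatest)
  ultimately show "0 \<le> f x - Inf (f ` F) \<and> f x - Inf (f ` F) \<le> d" by linarith
qed

lemma borsuk_number_hex_metric_le_3:
  assumes "compact F" "mdiameter hex_metric F > 0"
  shows "borsuk_number hex_metric F \<le> 3"
proof -
  define d where "d = mdiameter hex_metric F"
  have ne: "F \<noteq> {}" using assms(2) by (auto simp: mdiameter_def)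
  obtain c where c: "\<And>x y. x \<in> F \<Longrightarrow> y \<in> F \<Longrightarrow> dist x y \<le> c"
    using compact_imp_bounded[OF assms(1)] unfolding bounded_two_points by blast
  have "hex_dist x y \<le> 2 * c" if "x \<in> F" "y \<in> F" for x y
    using hex_dist_le_dist[of x y] c[OF that] by linarith
  then have "hex_dist x y \<le> d" if "x \<in> F" "y \<in> F" for x y
    using mdist_le_mdiameter[of F hex_metric "2 * c" x y] that unfolding d_def by simp
  \<comment> \<open>The third coordinate is taken with a minus sign so that the three cancel; after
    the shifts their sum is then constant on the plane.\<close>
  then have osc: "\<bar>x$1 - y$1\<bar> \<le> d" "\<bar>x$2 - y$2\<bar> \<le> d"
    "\<bar>- (x$1 + x$2) - - (y$1 + y$2)\<bar> \<le> d" if "x \<in> F" "y \<in> F" for x y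
    using that hex_dist_le_iff[of x y d] by (auto simp: abs_minus_commute)
  obtain a1 where a1: "\<And>x. x \<in> F \<Longrightarrow> 0 \<le> x$1 - a1 \<and> x$1 - a1 \<le> d"
    using oscillation_le_imp_range[of F "\<lambda>x. x$1", OF ne osc(1)] by blast
  obtain a2 where a2: "\<And>x. x \<in> F \<Longrightarrow> 0 \<le> x$2 - a2 \<and> x$2 - a2 \<le> d"
    using oscillation_le_imp_range[of F "\<lambda>x. x$2", OF ne osc(2)] by blast
  obtain a3 where a3: "\<And>x. x \<in> F \<Longrightarrow> 0 \<le> - (x$1 + x$2) - a3 \<and> - (x$1 + x$2) - a3 \<le> d"
    using oscillation_le_imp_range[of F "\<lambda>x. - (x$1 + x$2)", OF ne osc(3)] by blast
  have sum: "(x$1 - a1) + (x$2 - a2) + (- (x$1 + x$2) - a3) = - a1 - a2 - a3" for x :: "real^2"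
    by linarith
  obtain A B C where ABC: "F = A \<union> B \<union> C"
    "\<And>S f. S \<in> {A,B,C} \<Longrightarrow> f \<in> {\<lambda>x. x$1 - a1, \<lambda>x. x$2 - a2, \<lambda>x. - (x$1 + x$2) - a3}
       \<Longrightarrow> oscillation_le f (3/4 * d) S"
    by (rule three_part_cover[of F "\<lambda>x. x$1 - a1" d "\<lambda>x. x$2 - a2" "\<lambda>x. - (x$1 + x$2) - a3",
        OF a1 a2 a3 sum that])
  have "hex_dist x y \<le> 3/4 * d" if S: "S \<in> {A,B,C}" and xy: "x \<in> S" "y \<in> S" for S x y
  proof -
    \<comment> \<open>The shifts cancel in differences, so these three oscillation bounds amount to
      a bound on \<open>hex_dist\<close>.\<close>
    have "oscillation_le (\<lambda>x. x$1 - a1) (3/4 * d) S" "oscillation_le (\<lambda>x. x$2 - a2) (3/4 * d) S"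
      "oscillation_le (\<lambda>x. - (x$1 + x$2) - a3) (3/4 * d) S"
      by (intro ABC(2)[OF S] insertI1 insertI2)+
    from this[THEN oscillation_leD, OF xy] show ?thesis
      unfolding hex_dist_le_iff by linarith
  qed
  then show ?thesis
    using assms(2) by (intro borsuk_number_le_3I[OF ABC(1), of _ "3/4 * d"]) (simp_all add: d_def)
qed

section \<open>The minimum over all equivalent metrics\<close>

lemma borsuk_number_space_hex_metric: "borsuk_number_space hex_metric = 3"
proof (rule antisym)
  show "borsuk_number_space hex_metric \<le> 3"
    unfolding borsuk_number_space_def
    by (rule SUP_least) (simp add: borsuk_number_hex_metric_le_3)
  show "3 \<le> borsuk_number_space hex_metric"
    by (rule borsuk_number_space_ge_3) (simp_all add: hex_metric_equivalent)
qed

theorem theorem1: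
  shows "topological_borsuk_number (euclidean_metric :: (real^2) metric) = 3 \<and>
         (\<forall>\<rho>\<in>equivalent_metrics (euclidean_metric :: (real^2) metric). borsuk_number_space \<rho> \<ge> 3) \<and>
         (\<exists>\<rho>\<in>equivalent_metrics (euclidean_metric :: (real^2) metric). borsuk_number_space \<rho> = 3)"
proof -
  have lower: "3 \<le> borsuk_number_space \<rho>"
    if "\<rho> \<in> equivalent_metrics (euclidean_metric :: (real^2) metric)" for \<rho>
    using that by (intro borsuk_number_space_ge_3) simp_all
  have "topological_borsuk_number (euclidean_metric :: (real^2) metric) = 3"
    unfolding topological_borsuk_number_def
  proof (rule antisym)
    show "Inf (borsuk_number_space ` equivalent_metrics (euclidean_metric :: (real^2) metric)) \<le> 3"
      using INF_lower[OF hex_metric_equivalent, of borsuk_number_space]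
      by (simp add: borsuk_number_space_hex_metric)
    show "3 \<le> Inf (borsuk_number_space ` equivalent_metrics (euclidean_metric :: (real^2) metric))"
      using lower by (rule INF_greatest)
  qed
  then show ?thesis
    using lower hex_metric_equivalent borsuk_number_space_hex_metric by blast
qed

end
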